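(* Let $d \geq 1$ and $n \geq 3$ be integers, and let $L:(\mathbb{Z}/n\mathbb{Z})^d \to \{\mathsf{C},\mathsf{A},\mathsf{T}\}$ be any labeling. Then the number of occurrences of $\mathsf{CAT}$ in $L$ is at most $(3^{d-1}/2)n^d$. Moreover, equality is attained if and only if $n$ is a multiple of $4$ and $L$ is a generalized Patchell--Spiro labeling.
   Context: An occurrence of $\mathsf{CAT}$ in a labeling $L$ of $(\mathbb{Z}/n\mathbb{Z})^d$ is a pair $(x,y)$ with $x \in (\mathbb{Z}/n\mathbb{Z})^d$ and $y \in \{-1,0,1\}^d \setminus \{0\}$ such that $L(x)=\mathsf{C}$, $L(x+y)=\mathsf{A}$, $L(x+2y)=\mathsf{T}$; the number of occurrences is the number of such pairs. Suppose $n$ is a multiple of $4$ (so reductions of elements of $\mathbb{Z}/n\mathbb{Z}$ modulo $2$ and modulo $4$ are well defined). A generalized Patchell--Spiro labeling is a labeling of the following form: there exist a coordinate index $r \in \{1,\ldots,d\}$, a translation vector $a \in (\mathbb{Z}/n\mathbb{Z})^d$, and a choice of $\epsilon_y \in \{1,3\}$ for each $y \in \{0,1\}^{d-1}$, such that for every $x \in (\mathbb{Z}/n\mathbb{Z})^d$, writing $z = x-a$, $s = z_r$, and $y \in \{0,1\}^{d-1}$ for the reduction modulo $2$ of the vector obtained from $z$ by deleting its $r$-th coordinate: $L(x)=\mathsf{A}$ if $s$ is even; $L(x)=\mathsf{C}$ if $s$ is odd and $s \equiv \epsilon_y \pmod 4$; and $L(x)=\mathsf{T}$ if $s$ is odd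 and $s \equiv \epsilon_y + 2 \pmod 4$. *)

theory Defs
  imports Complex_Main "HOL-Library.FuncSet"
begin

datatype letter = C | A | T

text \<open>
  Elements of \<open>\<int>/n\<int>\<close> are represented by the residues \<open>0, \<dots>, n - 1\<close>, and vectors of length \<open>d\<close>
  by extensional functions on the index set \<open>{0, \<dots>, d - 1}\<close>. A labeling of the torus is a
  function \<^typ>\<open>(nat \<Rightarrow> int) \<Rightarrow> letter\<close>, of which only the values on \<open>torus n d\<close> matter.
\<close>

definition torus :: "nat \<Rightarrow> nat \<Rightarrow> (nat \<Rightarrow> int) set" where
  "torus n d = {..<d} \<rightarrow>\<^sub>E {0..<int n}"

definition directions :: "nat \<Rightarrow> (nat \<Rightarrow> int) set" where
  "directions d = ({..<d} \<rightarrow>\<^sub>E {-1, 0, 1}) - {\<lambda>i\<in>{..<d}. 0}"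

text \<open>\<open>shift n d x k y\<close> is the point \<open>x + k y\<close> of the torus.\<close>

definition shift :: "nat \<Rightarrow> nat \<Rightarrow> (nat \<Rightarrow> int) \<Rightarrow> int \<Rightarrow> (nat \<Rightarrow> int) \<Rightarrow> (nat \<Rightarrow> int)" where
  "shift n d x k y = (\<lambda>i\<in>{..<d}. (x i + k * y i) mod int n)"

definition CAT_occurrences ::
    "nat \<Rightarrow> nat \<Rightarrow> ((nat \<Rightarrow> int) \<Rightarrow> letter) \<Rightarrow> ((nat \<Rightarrow> int) \<times> (nat \<Rightarrow> int)) set" where
  "CAT_occurrences n d L =
     {(x, y). x \<in> torus n d \<and> y \<in> directions d \<and>
        L x = C \<and> L (shift n d x 1 y) = A \<and> L (shift n d x 2 y) = T}"

text \<open>Delete the \<open>r\<close>-th coordinate of a vector of length \<open>d\<close> and reduce the others modulo 2.\<close>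

definition delete_mod2 :: "nat \<Rightarrow> nat \<Rightarrow> (nat \<Rightarrow> int) \<Rightarrow> (nat \<Rightarrow> int)" where
  "delete_mod2 d r z = (\<lambda>i\<in>{..<d - 1}. (if i < r then z i else z (Suc i)) mod 2)"

text \<open>
  Only meaningful when \<open>n\<close> is a multiple of 4, so that the parities and the residues modulo 4 of
  the coordinates do not depend on the choice of representatives.
\<close>

definition generalized_Patchell_Spiro ::
    "nat \<Rightarrow> nat \<Rightarrow> ((nat \<Rightarrow> int) \<Rightarrow> letter) \<Rightarrow> bool" where
  "generalized_Patchell_Spiro n d L \<longleftrightarrow>
     (\<exists>r<d. \<exists>a\<in>torus n d. \<exists>\<epsilon> \<in> ({..<d - 1} \<rightarrow>\<^sub>E {0, 1}) \<rightarrow> {1, 3 :: int}.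
        \<forall>x\<in>torus n d.
          (let z = shift n d x (-1) a;
               s = z r;
               y = delete_mod2 d r z
           in (even s \<longrightarrow> L x = A) \<and>
              (odd s \<and> s mod 4 = \<epsilon> y mod 4 \<longrightarrow> L x = C) \<and>
              (odd s \<and> s mod 4 = (\<epsilon> y + 2) mod 4 \<longrightarrow> L x = T)))"

end

theory Submission
  imports Defs "HOL-Library.Function_Algebras"
begin

text \<open>
  An occurrence is a middle letter \<open>A\<close> together with an opposite pair \<open>{C, T}\<close> of its neighbours,
  so twice the number of occurrences is at most the size of the cut between \<open>A\<close> and its complement
  in the king's graph of the torus. With \<open>f = 1\<close> on \<open>A\<close> and \<open>f = -1\<close> elsewhere, the cut is
  governed by the quadratic form of the tensor product of the operators \<open>1 + S\<^sub>i + S\<^sub>i\<^sup>-\<^sup>1\<close>,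
  where \<open>S\<^sub>i\<close> is the unit translation along the \<open>i\<close>-th axis. Each factor lies
  between \<open>-1\<close> and \<open>3\<close>, so the form is at least \<open>-3\<^sup>d\<^sup>-\<^sup>1\<close> times the squared norm. In the
  extremal case the mixed second differences of \<open>f\<close> vanish, which forces the sign function \<open>f\<close> to
  alternate along one axis and to be constant along the others. Since then no opposite pair around
  an \<open>A\<close> may be wasted, translation by 2 along that axis exchanges \<open>C\<close> and \<open>T\<close>, while
  translation by 2 along any other axis preserves the labels.
\<close>

text \<open>As simp rules, the pointwise laws turn translates \<open>x + v\<close> of lattice points into abstractions.\<close>

declare plus_fun_apply [simp del] minus_apply [simp del] uminus_apply [simp del]

lemmas pointwise = plus_fun_apply minus_apply uminus_apply fun_eq_iff

section \<open>Periodic functions on the integer lattice\<close>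

definition reduce :: "nat \<Rightarrow> nat \<Rightarrow> (nat \<Rightarrow> int) \<Rightarrow> (nat \<Rightarrow> int)" where
  "reduce n d x = (\<lambda>i\<in>{..<d}. x i mod int n)"

text \<open>Torus functions are lifted to the lattice so that translation is plain addition. Since
  \<open>reduce\<close> yields \<open>undefined\<close> from \<open>d\<close> on, periodicity also
  forces independence of all coordinates with index at least \<open>d\<close>.\<close>

definition periodic :: "nat \<Rightarrow> nat \<Rightarrow> ((nat \<Rightarrow> int) \<Rightarrow> 'b) \<Rightarrow> bool" where
  "periodic n d f \<longleftrightarrow> (\<forall>x. f (reduce n d x) = f x)"

definition axis :: "nat \<Rightarrow> int \<Rightarrow> (nat \<Rightarrow> int)" where
  "axis i c = (\<lambda>j. if j = i then c else 0)"

lemma reduce_in_torus: "n > 0 \<Longrightarrow> reduce n d x \<in> torus n d"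
  by (auto simp: reduce_def torus_def)

lemma reduce_torus: "x \<in> torus n d \<Longrightarrow> reduce n d x = x"
  unfolding reduce_def torus_def
  by (rule ext) (auto simp: PiE_iff extensional_def)

lemma reduce_cong: "(\<And>i. i < d \<Longrightarrow> x i mod int n = y i mod int n) \<Longrightarrow> reduce n d x = reduce n d y"
  by (auto simp: reduce_def)

lemma reduce_reduce_add: "reduce n d (reduce n d x + v) = reduce n d (x + v)"
  by (rule reduce_cong) (simp add: reduce_def mod_simps pointwise)

lemma shift_eq_reduce: "shift n d x k y = reduce n d (\<lambda>i. x i + k * y i)"
  by (auto simp: shift_def reduce_def)

lemma finite_torus: "finite (torus n d)"
  by (simp add: torus_def finite_PiE)

lemma card_torus: "card (torus n d) = n ^ d"
  by (simp add: torus_def card_PiE)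

lemma periodicD: "periodic n d f \<Longrightarrow> f (reduce n d x) = f x"
  by (simp add: periodic_def)

lemma periodic_cong:
  "periodic n d f \<Longrightarrow> (\<And>i. i < d \<Longrightarrow> x i mod int n = y i mod int n) \<Longrightarrow> f x = f y"
  by (metis periodicD reduce_cong)

lemma periodic_translate: "periodic n d f \<Longrightarrow> periodic n d (\<lambda>x. f (x + v))"
  unfolding periodic_def by (metis reduce_reduce_add)

lemma periodic_translate_minus: "periodic n d f \<Longrightarrow> periodic n d (\<lambda>x. f (x - v))"
  using periodic_translate[of n d f "- v"] by simp

lemma periodic_comp: "periodic n d f \<Longrightarrow> periodic n d (\<lambda>x. h (f x))"
  by (simp add: periodic_def)

lemma periodic_comp2: "periodic n d f \<Longrightarrow> periodic n d g \<Longrightarrow> periodic n d (\<lambda>x. h (f x) (g x))"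
  by (simp add: periodic_def)

lemma periodic_all:
  assumes "periodic n d P" "n > 0" "\<And>x. x \<in> torus n d \<Longrightarrow> P x"
  shows "P x"
  using assms periodicD reduce_in_torus by metis

text \<open>Translating and then reducing permutes the torus; the translation by \<open>- v\<close>
  gives the inverse.\<close>

lemma sum_translate:
  fixes f :: "(nat \<Rightarrow> int) \<Rightarrow> 'b::comm_monoid_add"
  assumes f: "periodic n d f" and n: "n > 0"
  shows "(\<Sum>x\<in>torus n d. f (x + v)) = (\<Sum>x\<in>torus n d. f x)"
proof (rule sum.reindex_bij_witness[where i = "\<lambda>x. reduce n d (x - v)" and j = "\<lambda>x. reduce n d (x + v)"])
  have *: "reduce n d (reduce n d x - v) = reduce n d (x - v)" for x v
    using reduce_reduce_add[of n d x "- v"] by simp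
  fix x assume x: "x \<in> torus n d"
  show "reduce n d (reduce n d (x + v) - v) = x" "reduce n d (reduce n d (x - v) + v) = x"
    using x by (simp_all add: * reduce_reduce_add reduce_torus)
qed (auto simp: reduce_in_torus n periodicD[OF f])

subsection \<open>The quadratic form of the king's graph\<close>

text \<open>The tensor product of the operators \<open>1 + S + S^-1\<close> over the first
  \<open>k\<close> axes. Keeping \<open>k\<close> apart from the dimension \<open>d\<close> allows
  induction on \<open>k\<close> in a fixed torus.\<close>

primrec nbr_sum :: "nat \<Rightarrow> ((nat \<Rightarrow> int) \<Rightarrow> real) \<Rightarrow> (nat \<Rightarrow> int) \<Rightarrow> real" where
  "nbr_sum 0 f x = f x"
| "nbr_sum (Suc k) f x = nbr_sum k f x + nbr_sum k f (x + axis k 1) + nbr_sum k f (x - axis k 1)"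

definition king_form :: "nat \<Rightarrow> nat \<Rightarrow> nat \<Rightarrow> ((nat \<Rightarrow> int) \<Rightarrow> real) \<Rightarrow> real" where
  "king_form n d k f = (\<Sum>x\<in>torus n d. f x * nbr_sum k f x)"

definition sq_norm :: "nat \<Rightarrow> nat \<Rightarrow> ((nat \<Rightarrow> int) \<Rightarrow> real) \<Rightarrow> real" where
  "sq_norm n d f = (\<Sum>x\<in>torus n d. (f x)\<^sup>2)"

lemma periodic_nbr_sum: "periodic n d f \<Longrightarrow> periodic n d (nbr_sum k f)"
proof (induction k)
  case (Suc k)
  then have "periodic n d (nbr_sum k f)" by simp
  then have "nbr_sum k f (reduce n d x) = nbr_sum k f x"
    "nbr_sum k f (reduce n d x + v) = nbr_sum k f (x + v)"
    "nbr_sum k f (reduce n d x - v) = nbr_sum k f (x - v)" for x v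
    by (blast dest: periodicD periodic_translate periodic_translate_minus)+
  then show ?case
    by (simp add: periodic_def)
qed (simp add: periodic_def)

lemma nbr_sum_translate: "nbr_sum k (\<lambda>x. f (x + v)) x = nbr_sum k f (x + v)"
  by (induction k arbitrary: x) (simp_all add: algebra_simps)

lemma nbr_sum_add: "nbr_sum k (\<lambda>x. f x + g x) x = nbr_sum k f x + nbr_sum k g x"
  by (induction k arbitrary: x) simp_all

lemma nbr_sum_diff: "nbr_sum k (\<lambda>x. f x - g x) x = nbr_sum k f x - nbr_sum k g x"
  by (induction k arbitrary: x) simp_all

lemma nbr_sum_mult: "nbr_sum k (\<lambda>x. c * f x) x = c * nbr_sum k f x"
  by (induction k arbitrary: x) (simp_all add: algebra_simps)

lemma king_form_mult: "king_form n d k (\<lambda>x. c * f x) = c\<^sup>2 * king_form n d k f"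
  by (simp add: king_form_def nbr_sum_mult sum_distrib_left power2_eq_square mult_ac)

lemma sq_norm_mult: "sq_norm n d (\<lambda>x. c * f x) = c\<^sup>2 * sq_norm n d f"
  by (simp add: sq_norm_def sum_distrib_left power_mult_distrib)

lemma sq_norm_nonneg: "sq_norm n d f \<ge> 0"
  by (simp add: sq_norm_def sum_nonneg)

lemma sq_norm_eq_0:
  assumes f: "periodic n d f" and n: "n > 0" and 0: "sq_norm n d f = 0"
  shows "f x = 0"
proof -
  have "f x = 0" if "x \<in> torus n d" for x
    using 0 that by (simp add: sq_norm_def sum_nonneg_eq_0_iff finite_torus)
  then show ?thesis
    using periodic_all[OF periodic_comp[OF f, of "\<lambda>v. v = 0"] n] by blast
qed

text \<open>
  The identity \<open>4 (1 + S + S\<^sup>-\<^sup>1) = 3 (1 + S) (1 + S)\<^sup>* - (1 - S) (1 - S)\<^sup>*\<close>.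
\<close>

lemma king_form_Suc:
  assumes f: "periodic n d f" and n: "n > 0"
  shows "4 * king_form n d (Suc k) f =
    3 * king_form n d k (\<lambda>x. f x + f (x + axis k 1)) - king_form n d k (\<lambda>x. f x - f (x + axis k 1))"
proof -
  let ?e = "axis k 1" and ?R = "nbr_sum k f"
  note R = periodic_nbr_sum[OF f, of k]
  have 1: "(\<Sum>x\<in>torus n d. f (x + ?e) * ?R (x + ?e)) = (\<Sum>x\<in>torus n d. f x * ?R x)"
    by (rule sum_translate[OF periodic_comp2[OF f R, of "(*)"] n])
  have 2: "(\<Sum>x\<in>torus n d. f x * ?R (x - ?e)) = (\<Sum>x\<in>torus n d. f (x + ?e) * ?R x)"
    using sum_translate[OF periodic_comp2[OF f periodic_translate_minus[OF R, of ?e], of "(*)"] n, of ?e]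
    by simp
  show ?thesis
    unfolding king_form_def
    by (simp add: nbr_sum_add nbr_sum_diff nbr_sum_translate algebra_simps sum.distrib sum_subtractf 1 2)
qed

lemma sq_norm_parallelogram:
  assumes f: "periodic n d f" and n: "n > 0"
  shows "sq_norm n d (\<lambda>x. f x + f (x + v)) + sq_norm n d (\<lambda>x. f x - f (x + v)) = 4 * sq_norm n d f"
proof -
  have 1: "(\<Sum>x\<in>torus n d. (f (x + v))\<^sup>2) = (\<Sum>x\<in>torus n d. (f x)\<^sup>2)"
    by (rule sum_translate[OF periodic_comp[OF f, of "\<lambda>t. t\<^sup>2"] n])
  show ?thesis
    unfolding sq_norm_def
    by (simp add: power2_sum power2_diff sum.distrib sum_subtractf 1)
qed

lemma periodic_sum_step: "periodic n d f \<Longrightarrow> periodic n d (\<lambda>x. f x + f (x + v) :: real)"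
  and periodic_diff_step: "periodic n d f \<Longrightarrow> periodic n d (\<lambda>x. f x - f (x + v) :: real)"
  using periodic_comp2[of n d f "\<lambda>x. f (x + v)" "(+)"] periodic_comp2[of n d f "\<lambda>x. f (x + v)" "(-)"]
  by (simp_all add: periodic_translate)

text \<open>The lower bound carries a factor 3 on the left so that \<open>k = 0\<close> is covered.\<close>

lemma king_form_bounds:
  assumes "periodic n d f" and n: "n > 0"
  shows "- (3 ^ k * sq_norm n d f) \<le> 3 * king_form n d k f"
    and "king_form n d k f \<le> 3 ^ k * sq_norm n d f"
proof -
  \<comment> \<open>One induction serves both bounds: in \<open>king_form_Suc\<close> the form of
    the difference enters negatively, so each bound at \<open>Suc k\<close> uses the opposite bound
    for the difference.\<close>
  have "- (3 ^ k * sq_norm n d f) \<le> 3 * king_form n d k f \<and> king_form n d k f \<le> 3 ^ k * sq_norm n d f"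
    using assms(1)
  proof (induction k arbitrary: f)
    case 0
    have "king_form n d 0 f = sq_norm n d f"
      by (simp add: king_form_def sq_norm_def power2_eq_square)
    then show ?case
      using sq_norm_nonneg[of n d f] by simp
  next
    case (Suc k)
    let ?U = "\<lambda>x. f x + f (x + axis k 1)" and ?V = "\<lambda>x. f x - f (x + axis k 1)"
    have N: "4 * (3 ^ k * sq_norm n d f) = 3 ^ k * sq_norm n d ?U + 3 ^ k * sq_norm n d ?V"
      using sq_norm_parallelogram[OF Suc.prems n, of "axis k 1"] by (simp flip: distrib_left)
    have "0 \<le> 3 ^ k * sq_norm n d ?V"
      by (simp add: sq_norm_nonneg)
    moreover have "0 \<le> 3 ^ k * sq_norm n d ?U"
      by (simp add: sq_norm_nonneg)
    moreover note Suc.IH[OF periodic_sum_step[OF Suc.prems, of "axis k 1"]]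
      Suc.IH[OF periodic_diff_step[OF Suc.prems, of "axis k 1"]]
      king_form_Suc[OF Suc.prems n, of k] N
    ultimately show ?case
      unfolding power_Suc mult.assoc by linarith
  qed
  then show "- (3 ^ k * sq_norm n d f) \<le> 3 * king_form n d k f"
    and "king_form n d k f \<le> 3 ^ k * sq_norm n d f" by auto
qed

section \<open>Equality in the two bounds\<close>

lemma king_form_max_invariant:
  assumes "periodic n d f" and n: "n > 0"
    and "king_form n d k f = 3 ^ k * sq_norm n d f" and "i < k"
  shows "f (x + axis i 1) = f x"
  using assms(1,3,4)
proof (induction k)
  case (Suc k)
  let ?U = "\<lambda>x. f x + f (x + axis k 1)" and ?V = "\<lambda>x. f x - f (x + axis k 1)"
  have N: "4 * (3 ^ k * sq_norm n d f) = 3 ^ k * sq_norm n d ?U + 3 ^ k * sq_norm n d ?V"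
    using sq_norm_parallelogram[OF Suc.prems(1) n, of "axis k 1"] by (simp flip: distrib_left)
  have *: "0 \<le> 3 ^ k * sq_norm n d ?V"
    by (simp add: sq_norm_nonneg)
  \<comment> \<open>In the upper estimate the norm of \<open>?V\<close> has weight
    \<open>3 ^ k / 3\<close> where \<open>3 * 3 ^ k\<close> is allowed, so equality forces it to
    vanish.\<close>
  have "3 ^ k * sq_norm n d ?V \<le> 0"
    using king_form_bounds[OF periodic_sum_step[OF Suc.prems(1), of "axis k 1"] n, of k]
      king_form_bounds[OF periodic_diff_step[OF Suc.prems(1), of "axis k 1"] n, of k]
      king_form_Suc[OF Suc.prems(1) n, of k] N Suc.prems(2) *
    unfolding power_Suc mult.assoc by linarith
  then have "sq_norm n d ?V = 0"
    using * by simp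
  from sq_norm_eq_0[OF periodic_diff_step[OF Suc.prems(1)] n this]
  have k: "f (x + axis k 1) = f x" for x by simp
  \<comment> \<open>With \<open>?U\<close> equal to \<open>2 f\<close> and \<open>?V\<close> equal
    to 0, the last factor just multiplies the form by 3, so \<open>f\<close> is maximal for
    \<open>k\<close> axes too.\<close>
  have "king_form n d k f = 3 ^ k * sq_norm n d f"
  proof -
    have "king_form n d k ?U = 4 * king_form n d k f"
      using king_form_mult[of n d k 2 f] by (simp add: k)
    moreover have "king_form n d k ?V = 0"
      using king_form_mult[of n d k 0 f] by (simp add: k)
    ultimately show ?thesis
      using king_form_Suc[OF Suc.prems(1) n, of k] Suc.prems(2) by simp
  qed
  with Suc k show ?case
    by (cases "i = k") auto
qed simp

text \<open>The lower bound combines the lower bound for the sum with the upper bound for the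
  difference, so equality must hold in both.\<close>

lemma king_form_min_Suc:
  assumes f: "periodic n d f" and n: "n > 0"
    and min: "3 * king_form n d (Suc k) f = - (3 ^ Suc k * sq_norm n d f)"
  shows "3 * king_form n d k (\<lambda>x. f x + f (x + axis k 1)) =
      - (3 ^ k * sq_norm n d (\<lambda>x. f x + f (x + axis k 1)))" (is "?l = ?r")
    and "king_form n d k (\<lambda>x. f x - f (x + axis k 1)) =
      3 ^ k * sq_norm n d (\<lambda>x. f x - f (x + axis k 1))" (is "?l' = ?r'")
proof -
  let ?U = "\<lambda>x. f x + f (x + axis k 1)" and ?V = "\<lambda>x. f x - f (x + axis k 1)"
  have N: "4 * (3 ^ k * sq_norm n d f) = 3 ^ k * sq_norm n d ?U + 3 ^ k * sq_norm n d ?V"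
    using sq_norm_parallelogram[OF f n, of "axis k 1"] by (simp flip: distrib_left)
  have "?l = ?r \<and> ?l' = ?r'"
    using king_form_bounds[OF periodic_sum_step[OF f, of "axis k 1"] n, of k]
      king_form_bounds[OF periodic_diff_step[OF f, of "axis k 1"] n, of k]
      king_form_Suc[OF f n, of k] N min
    unfolding power_Suc mult.assoc by linarith
  then show "?l = ?r" "?l' = ?r'" by auto
qed

text \<open>If \<open>j\<close> is the last axis, the difference along it is maximal and hence
  invariant along \<open>i\<close>. Smaller \<open>j\<close> are reached through the sum along the
  last axis, which is again minimal.\<close>

lemma king_form_min_mixed_difference:
  assumes "periodic n d f" and n: "n > 0"
    and "3 * king_form n d k f = - (3 ^ k * sq_norm n d f)" and "i < j" "j < k"
  shows "f x - f (x + axis i 1) = f (x + axis j 1) - f (x + axis j 1 + axis i 1)"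
  using assms(1,3,5)
proof (induction k arbitrary: f x)
  case (Suc k)
  let ?U = "\<lambda>x. f x + f (x + axis k 1)" and ?V = "\<lambda>x. f x - f (x + axis k 1)"
  note min = king_form_min_Suc[OF Suc.prems(1) n Suc.prems(2)]
  have V: "?V (x + axis l 1) = ?V x" if "l < k" for l x
    using king_form_max_invariant[OF periodic_diff_step[OF Suc.prems(1)] n min(2) that] .
  show ?case
  proof (cases "j = k")
    case True
    then show ?thesis using V[of i x] \<open>i < j\<close> by (simp add: add_ac)
  next
    case False
    then have "j < k" using Suc.prems by simp
    \<comment> \<open>\<open>?U + ?V\<close> is \<open>2 f\<close>. The identity for
      \<open>?U\<close> is the induction hypothesis, that for \<open>?V\<close> follows from its
      invariance along \<open>j\<close>.\<close>
    from Suc.IH[OF periodic_sum_step[OF Suc.prems(1)] min(1) this, of x]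
      V[OF \<open>j < k\<close>, of x] V[OF \<open>j < k\<close>, of "x + axis i 1"]
    show ?thesis by (simp add: add_ac)
  qed
qed simp

lemma nbr_sum_invariant:
  assumes "\<And>i x. i < k \<Longrightarrow> f (x + axis i 1) = f x"
  shows "nbr_sum k f x = 3 ^ k * f x"
  using assms
proof (induction k arbitrary: x)
  case (Suc k)
  have "f (x - axis k 1) = f x"
    using Suc.prems[of k "x - axis k 1"] by simp
  with Suc show ?case by simp
qed simp

text \<open>The factor at axis \<open>r\<close> acts as \<open>1 - 1 - 1\<close>, every other one as
  3; the factor 3 on the left avoids the exponent \<open>k - 1\<close>.\<close>

lemma nbr_sum_alternating:
  assumes "r < k" and "\<And>i x. i < k \<Longrightarrow> i \<noteq> r \<Longrightarrow> f (x + axis i 1) = f x"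
    and alt: "\<And>x. f (x + axis r 1) = - f x"
  shows "3 * nbr_sum k f x = - (3 ^ k) * f x"
  using assms(1,2)
proof (induction k arbitrary: x)
  case (Suc k)
  show ?case
  proof (cases "r = k")
    case True
    have "f (x - axis r 1) = - f x"
      using alt[of "x - axis r 1"] by simp
    with True Suc.prems alt show ?thesis
      by (simp add: nbr_sum_invariant)
  next
    case False
    have "f (x - axis k 1) = f x"
      using Suc.prems(2)[of k "x - axis k 1"] False by simp
    with Suc.IH[of x] Suc.IH[of "x + axis k 1"] Suc.IH[of "x - axis k 1"] Suc.prems False
    show ?thesis by (simp add: distrib_left)
  qed
qed simp

text \<open>If \<open>r\<close> is the last axis, the sum along it is invariant along all earlier
  axes, so its form is maximal as well as minimal and the sum vanishes. Otherwise the sum along the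
  last axis is \<open>2 f\<close> and the induction descends.\<close>

lemma king_form_min_alternating:
  assumes "periodic n d f" and n: "n > 0"
    and "3 * king_form n d k f = - (3 ^ k * sq_norm n d f)" and "r < k"
    and "\<And>i x. i < k \<Longrightarrow> i \<noteq> r \<Longrightarrow> f (x + axis i 1) = f x"
  shows "f (x + axis r 1) = - f x"
  using assms(1,3,4,5)
proof (induction k)
  case (Suc k)
  let ?U = "\<lambda>x. f x + f (x + axis k 1)"
  note min = king_form_min_Suc[OF Suc.prems(1) n Suc.prems(2)]
  show ?case
  proof (cases "r = k")
    case True
    have "nbr_sum k ?U x = 3 ^ k * ?U x" for x
    proof (rule nbr_sum_invariant)
      fix i x assume "i < k"
      then have "f (x + axis i 1) = f x" "f (x + axis k 1 + axis i 1) = f (x + axis k 1)"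
        using True by (simp_all add: Suc.prems(4))
      then show "?U (x + axis i 1) = ?U x" by (simp add: add_ac)
    qed
    then have "king_form n d k ?U = 3 ^ k * sq_norm n d ?U"
      by (simp add: king_form_def sq_norm_def sum_distrib_left power2_eq_square mult_ac)
    with min(1) have "3 ^ k * sq_norm n d ?U = 0" by linarith
    then have "sq_norm n d ?U = 0" by simp
    then have "?U x = 0"
      by (rule sq_norm_eq_0[OF periodic_sum_step[OF Suc.prems(1)] n])
    with True show ?thesis by (simp add: add_eq_0_iff)
  next
    case False
    then have U: "?U = (\<lambda>x. 2 * f x)" by (simp add: Suc.prems(4))
    have "king_form n d k (\<lambda>x. 2 * f x) = 4 * king_form n d k f"
      using king_form_mult[of n d k 2 f] by simp
    moreover have "3 ^ k * sq_norm n d (\<lambda>x. 2 * f x) = 4 * (3 ^ k * sq_norm n d f)"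
      using sq_norm_mult[of n d 2 f] by simp
    ultimately have "3 * king_form n d k f = - (3 ^ k * sq_norm n d f)"
      using min(1)[unfolded U] by linarith
    then show ?thesis
    proof (rule Suc.IH[OF Suc.prems(1)])
      show "r < k" using Suc.prems(3) False by simp
      show "f (y + axis i 1) = f y" if "i < k" "i \<noteq> r" for i y
        by (rule Suc.prems(4)) (use that in simp_all)
    qed
  qed
qed simp

text \<open>The coordinates from \<open>k\<close> on are kept explicitly because an extensional
  \<open>y\<close> is \<open>undefined\<close> there.\<close>

lemma nbr_sum_eq_sum:
  "nbr_sum k f x = (\<Sum>y\<in>{..<k} \<rightarrow>\<^sub>E {-1, 0, 1}. f (\<lambda>i. if i < k then x i + y i else x i))"
proof (induction k arbitrary: x)
  case (Suc k)
  let ?Y = "{..<k} \<rightarrow>\<^sub>E {-1, 0, 1::int}"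
  let ?h = "\<lambda>x y. \<lambda>i. if i < k then x i + y i else x i :: int"
  have "(\<Sum>y\<in>{..<Suc k} \<rightarrow>\<^sub>E {-1, 0, 1}. f (\<lambda>i. if i < Suc k then x i + y i else x i))
    = (\<Sum>(c, y)\<in>{-1, 0, 1} \<times> ?Y. f (?h (x + axis k c) y))"
  \<comment> \<open>The bijection splits off the new coordinate \<open>y k\<close> as
    \<open>c\<close>; resetting it to \<open>undefined\<close> leaves an extensional move on the
    first \<open>k\<close> axes.\<close>
  proof (rule sum.reindex_bij_witness[where i = "\<lambda>(c, y). y(k := c)" and j = "\<lambda>y. (y k, y(k := undefined))"],
      goal_cases)
    case (1 y) then show ?case by auto
  next
    case (2 y) then show ?case by (auto simp: PiE_iff extensional_def)
  next
    case (3 b)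
    then obtain c y where b: "b = (c, y)" "y \<in> ?Y" by blast
    from b(2) have "y k = undefined" by (rule PiE_arb) simp
    with b(1) show ?case by (simp add: fun_upd_idem)
  next
    case (4 b)
    then obtain c y where b: "b = (c, y)" "c \<in> {-1, 0, 1}" "y \<in> ?Y" by blast
    then show ?case by (simp add: lessThan_Suc PiE_fun_upd)
  next
    case (5 y)
    have "?h (x + axis k (y k)) (y(k := undefined)) = (\<lambda>i. if i < Suc k then x i + y i else x i)"
      by (rule ext) (simp add: axis_def plus_fun_apply less_Suc_eq)
    then show ?case by simp
  qed
  also have "\<dots> = (\<Sum>c\<in>{-1, 0, 1}. nbr_sum k f (x + axis k c))"
    by (simp add: Suc.IH sum.cartesian_product)
  also have "\<dots> = nbr_sum k f (x + axis k (-1)) + nbr_sum k f (x + axis k 0) + nbr_sum k f (x + axis k 1)"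
    by (simp add: add.assoc)
  also have "x + axis k (-1) = x - axis k 1"
    by (rule ext) (simp add: axis_def pointwise(1,2))
  also have "x + axis k 0 = x"
    by (rule ext) (simp add: axis_def pointwise(1,2))
  finally show ?case by simp
qed simp

lemma nbr_sum_periodic:
  assumes "periodic n d f"
  shows "nbr_sum d f x = (\<Sum>y\<in>{..<d} \<rightarrow>\<^sub>E {-1, 0, 1}. f (x + y))"
  unfolding nbr_sum_eq_sum
  by (intro sum.cong refl periodic_cong[OF assms]) (simp add: pointwise)

subsection \<open>Functions with prescribed behaviour under axis translations\<close>

lemma translate_invariant_axis:
  assumes "\<And>x. g (x + axis i m) = g x"
  shows "g (x + axis i (m * c)) = g x"
proof (induction c rule: int_induct[where k = 0])
  case base
  have "axis i (m * 0) = 0" by (auto simp: axis_def pointwise)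
  then show ?case by (simp only: add_0_right)
next
  case (step1 c)
  have "x + axis i (m * (c + 1)) = (x + axis i (m * c)) + axis i m"
    by (auto simp: axis_def pointwise algebra_simps)
  with step1 assms show ?case by metis
next
  case (step2 c)
  have "x + axis i (m * c) = (x + axis i (m * (c - 1))) + axis i m"
    by (auto simp: axis_def pointwise algebra_simps)
  with step2 assms show ?case by metis
qed

lemma translate_alternating_axis:
  fixes g :: "(nat \<Rightarrow> int) \<Rightarrow> real"
  assumes alt: "\<And>x. g (x + axis i m) = - g x"
  shows "g (x + axis i (m * c)) = (if even c then g x else - g x)"
proof (induction c rule: int_induct[where k = 0])
  case base
  have "axis i (m * 0) = 0" by (auto simp: axis_def pointwise)
  then show ?case by (simp only: add_0_right) simp
next
  case (step1 c)
  have "x + axis i (m * (c + 1)) = (x + axis i (m * c)) + axis i m"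
    by (auto simp: axis_def pointwise algebra_simps)
  with alt have "g (x + axis i (m * (c + 1))) = - g (x + axis i (m * c))" by metis
  with step1 show ?case by auto
next
  case (step2 c)
  have "x + axis i (m * c) = (x + axis i (m * (c - 1))) + axis i m"
    by (auto simp: axis_def pointwise algebra_simps)
  with alt have "g (x + axis i (m * c)) = - g (x + axis i (m * (c - 1)))" by metis
  with step2 show ?case by (auto split: if_splits)
qed

text \<open>The components other than the \<open>r\<close>-th are added one axis at a time, each
  without effect; those from \<open>d\<close> on are invisible by periodicity.\<close>

lemma translate_other_axes:
  assumes g: "periodic n d g"
    and inv: "\<And>i x. i < d \<Longrightarrow> i \<noteq> r \<Longrightarrow> g (x + axis i m) = g x"
  shows "g (x + (\<lambda>i. m * v i)) = g (x + axis r (m * v r))"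
proof -
  have "k \<le> d \<Longrightarrow> g (x + axis r (m * v r) + (\<lambda>i. if i < k \<and> i \<noteq> r then m * v i else 0)) =
    g (x + axis r (m * v r))" for k
  proof (induction k)
    case 0
    then show ?case by (intro periodic_cong[OF g]) (simp add: pointwise)
  next
    case (Suc k)
    let ?p = "x + axis r (m * v r) + (\<lambda>i. if i < k \<and> i \<noteq> r then m * v i else 0)"
    let ?q = "x + axis r (m * v r) + (\<lambda>i. if i < Suc k \<and> i \<noteq> r then m * v i else 0)"
    show ?case
    proof (cases "k = r")
      case True
      then have "?q = ?p" by (auto simp: pointwise)
      with Suc show ?thesis by simp
    next
      case False
      then have "?q = ?p + axis k (m * v k)" by (auto simp: axis_def pointwise)
      moreover have "g (?p + axis k (m * v k)) = g ?p"
        using Suc.prems False by (intro translate_invariant_axis inv) auto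
      ultimately show ?thesis using Suc by (simp only: Suc_leD)
    qed
  qed
  from this[of d]
  have "g (x + axis r (m * v r) + (\<lambda>i. if i < d \<and> i \<noteq> r then m * v i else 0)) =
    g (x + axis r (m * v r))" by simp
  moreover have "g (x + axis r (m * v r) + (\<lambda>i. if i < d \<and> i \<noteq> r then m * v i else 0)) =
    g (x + (\<lambda>i. m * v i))"
    by (intro periodic_cong[OF g]) (auto simp: axis_def pointwise)
  ultimately show ?thesis by simp
qed

text \<open>Applied with \<open>m = 1\<close> to the sign of \<open>A\<close> and with
  \<open>m = 2\<close> to the sign that separates \<open>C\<close> from \<open>T\<close>.\<close>

lemma translate_alternating:
  fixes g :: "(nat \<Rightarrow> int) \<Rightarrow> real"
  assumes g: "periodic n d g"
    and inv: "\<And>i x. i < d \<Longrightarrow> i \<noteq> r \<Longrightarrow> g (x + axis i m) = g x"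
    and alt: "\<And>x. g (x + axis r m) = - g x"
  shows "g (x + (\<lambda>i. m * v i)) = (if even (v r) then g x else - g x)"
  using translate_other_axes[of n d g r m x v] g inv translate_alternating_axis[of g r m x "v r"] alt
  by simp

section \<open>Sign functions attaining the lower bound\<close>

lemma sign_function_single_axis:
  fixes f :: "(nat \<Rightarrow> int) \<Rightarrow> real"
  assumes f: "periodic n d f" and n: "n > 0"
    and sign: "\<And>x. f x = 1 \<or> f x = -1"
    and min: "3 * king_form n d d f = - (3 ^ d * sq_norm n d f)" and "i < d" "j < d" "i \<noteq> j"
    and i: "f (p + axis i 1) \<noteq> f p" and j: "f (q + axis j 1) \<noteq> f q"
  shows False
proof -
  have mixed: "f x - f (x + axis k 1) = f (x + axis l 1) - f (x + axis l 1 + axis k 1)"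
    if "k < d" "l < d" "k \<noteq> l" for k l x
  proof (cases "k < l")
    case True
    show ?thesis using king_form_min_mixed_difference[of n d f d k l x] f n min True that(2) by simp
  next
    case False
    then have "f x - f (x + axis l 1) = f (x + axis k 1) - f (x + axis k 1 + axis l 1)"
      using king_form_min_mixed_difference[of n d f d l k x] f n min that by simp
    then show ?thesis by (simp add: add_ac)
  qed
  \<comment> \<open>Vanishing mixed differences make the difference along axis \<open>k\<close> a
    function of the \<open>k\<close>-th coordinate alone.\<close>
  have dep: "f (x + v) - f (x + v + axis k 1) = f x - f (x + axis k 1)"
    if "k < d" "v k = 0" for k x v
  proof -
    let ?D = "\<lambda>x. f x - f (x + axis k 1)"
    have "?D (x + (\<lambda>i. 1 * v i)) = ?D (x + axis k (1 * v k))"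
    proof (rule translate_other_axes[of n d ?D])
      show "?D (y + axis l 1) = ?D y" if "l < d" "l \<noteq> k" for l y
        using mixed[of k l y] \<open>k < d\<close> that by simp
    qed (rule periodic_diff_step[OF f])
    moreover have "axis k 0 = 0" by (auto simp: axis_def pointwise)
    ultimately show ?thesis using that by simp
  qed
  \<comment> \<open>This point has its \<open>i\<close>-th coordinate from \<open>p\<close> and its
    \<open>j\<close>-th from \<open>q\<close>, so at \<open>z\<close> the sign changes along both
    axes.\<close>
  define z where "z = p(j := q j)"
  have "f z - f (z + axis i 1) = f p - f (p + axis i 1)"
    using dep[of i "z - p" p] assms by (simp add: z_def pointwise(2))
  moreover have "f z - f (z + axis j 1) = f q - f (q + axis j 1)"
    using dep[of j "z - q" q] assms by (simp add: z_def pointwise(2))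
  \<comment> \<open>The mixed difference would now force \<open>f (z + axis j 1 + axis i 1)\<close>
    to be \<open>-3 * f z\<close>, which is not a sign.\<close>
  ultimately show False
    using mixed[OF \<open>i < d\<close> \<open>j < d\<close> \<open>i \<noteq> j\<close>, of z] i j
      sign[of z] sign[of "z + axis i 1"] sign[of "z + axis j 1"] sign[of "z + axis j 1 + axis i 1"]
    by auto
qed

lemma sign_function_min_alternating:
  fixes f :: "(nat \<Rightarrow> int) \<Rightarrow> real"
  assumes f: "periodic n d f" and n: "n > 0" and d: "d > 0"
    and sign: "\<And>x. f x = 1 \<or> f x = -1"
    and min: "3 * king_form n d d f = - (3 ^ d * sq_norm n d f)"
  obtains r where "r < d" "\<And>x. f (x + axis r 1) = - f x"
    "\<And>i x. i < d \<Longrightarrow> i \<noteq> r \<Longrightarrow> f (x + axis i 1) = f x"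
proof -
  obtain r where r: "r < d" "\<And>i x. i < d \<Longrightarrow> i \<noteq> r \<Longrightarrow> f (x + axis i 1) = f x"
  proof (cases "\<exists>r<d. \<exists>p. f (p + axis r 1) \<noteq> f p")
    case True
    then obtain r p where "r < d" "f (p + axis r 1) \<noteq> f p" by blast
    then show ?thesis
      using sign_function_single_axis[of n d f r _ p] f n sign min that[of r] by blast
  next
    case False
    \<comment> \<open>If the sign changes along no axis, every axis has the invariance asked of
      \<open>r\<close>; alternation is derived afterwards from minimality.\<close>
    then show ?thesis using that[of 0] d by simp
  qed
  have alt: "f (x + axis r 1) = - f x" for x
    using king_form_min_alternating[of n d f d r x] f n min r by simp
  show thesis
    using that[of r] r alt by simp
qed

subsection \<open>Counting occurrences by their middle letter\<close>

text \<open>Unlike \<open>directions\<close> this keeps the zero move, which occurs in the expansion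
  of the tensor product; it yields no occurrence.\<close>

definition king_moves :: "nat \<Rightarrow> (nat \<Rightarrow> int) set" where
  "king_moves d = {..<d} \<rightarrow>\<^sub>E {-1, 0, 1}"

definition a_sign :: "((nat \<Rightarrow> int) \<Rightarrow> letter) \<Rightarrow> (nat \<Rightarrow> int) \<Rightarrow> real" where
  "a_sign M x = (if M x = A then 1 else -1)"

text \<open>A defect is a cut edge at a letter \<open>A\<close> that lies in no occurrence.\<close>

definition defect :: "((nat \<Rightarrow> int) \<Rightarrow> letter) \<Rightarrow> (nat \<Rightarrow> int) \<Rightarrow> (nat \<Rightarrow> int) \<Rightarrow> bool" where
  "defect M x v \<longleftrightarrow> M x = A \<and> M (x + v) \<noteq> A \<and> {M (x + v), M (x - v)} \<noteq> {C, T}"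

lemma finite_king_moves: "finite (king_moves d)"
  by (simp add: king_moves_def finite_PiE)

lemma card_king_moves: "card (king_moves d) = 3 ^ d"
  by (simp add: king_moves_def card_PiE numeral_3_eq_3)

lemma periodic_a_sign: "periodic n d M \<Longrightarrow> periodic n d (a_sign M)"
  by (simp add: periodic_def a_sign_def)

lemma a_sign_cases: "a_sign M x = 1 \<or> a_sign M x = -1"
  by (simp add: a_sign_def)

lemma a_sign_eq_iff: "a_sign M x = 1 \<longleftrightarrow> M x = A" "a_sign M x = -1 \<longleftrightarrow> M x \<noteq> A"
  by (simp_all add: a_sign_def)

lemma sq_norm_a_sign: "sq_norm n d (a_sign M) = real n ^ d"
proof -
  have "(a_sign M x)\<^sup>2 = 1" for x by (simp add: a_sign_def)
  then show ?thesis by (simp add: sq_norm_def card_torus)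
qed

lemma periodic_lift: "periodic n d (\<lambda>x. L (reduce n d x))"
proof -
  have "reduce n d (reduce n d x) = reduce n d x" for x
    by (rule reduce_cong) (simp add: reduce_def)
  then show ?thesis by (simp add: periodic_def)
qed

lemma card_CAT_occurrences:
  fixes n d :: nat and L :: "(nat \<Rightarrow> int) \<Rightarrow> letter"
  assumes n: "n > 0"
  defines "M \<equiv> \<lambda>x. L (reduce n d x)"
  shows "real (card (CAT_occurrences n d L)) =
    (\<Sum>y\<in>king_moves d. \<Sum>x\<in>torus n d. of_bool (M (x - y) = C \<and> M x = A \<and> M (x + y) = T))"
proof -
  have M: "periodic n d M"
    unfolding M_def by (rule periodic_lift)
  have s1: "shift n d x 1 y = reduce n d (x + y)" for x y
    unfolding shift_eq_reduce by (rule reduce_cong) (simp add: plus_fun_apply)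
  have s2: "shift n d x 2 y = reduce n d (x + y + y)" for x y
    unfolding shift_eq_reduce by (rule reduce_cong) (simp add: plus_fun_apply algebra_simps)
  let ?P = "\<lambda>y x. M x = C \<and> M (x + y) = A \<and> M (x + y + y) = T"
  have zero: "\<not> ?P (\<lambda>i\<in>{..<d}. 0) x" for x
  proof -
    have "M (x + (\<lambda>i\<in>{..<d}. 0)) = M x"
      by (rule periodic_cong[OF M]) (simp add: plus_fun_apply)
    then show ?thesis by auto
  qed
  have "CAT_occurrences n d L = {(x, y). x \<in> torus n d \<and> y \<in> directions d \<and> ?P y x}"
    unfolding CAT_occurrences_def s1 s2 by (auto simp: M_def reduce_torus)
  also have "\<dots> = (torus n d \<times> king_moves d) \<inter> {(x, y). ?P y x}"
    using zero by (auto simp: directions_def king_moves_def)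
  finally have "real (card (CAT_occurrences n d L)) =
      (\<Sum>z\<in>torus n d \<times> king_moves d. of_bool (case z of (x, y) \<Rightarrow> ?P y x))"
    by (subst sum_of_bool_eq) (simp_all add: finite_torus finite_king_moves)
  also have "\<dots> = (\<Sum>x\<in>torus n d. \<Sum>y\<in>king_moves d. of_bool (?P y x))"
    by (simp add: sum.cartesian_product split_def)
  also have "\<dots> = (\<Sum>y\<in>king_moves d. \<Sum>x\<in>torus n d. of_bool (?P y x))"
    by (rule sum.swap)
  also have "\<dots> = (\<Sum>y\<in>king_moves d. \<Sum>x\<in>torus n d.
      of_bool (M (x - y) = C \<and> M x = A \<and> M (x + y) = T))"
  \<comment> \<open>Translation by \<open>y\<close> makes the middle letter, instead of the initial
    \<open>C\<close>, the point of summation.\<close>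
  proof (rule sum.cong[OF refl])
    fix y
    have "periodic n d (\<lambda>x. of_bool (M (x - y) = C \<and> M x = A \<and> M (x + y) = T) :: real)"
      using M periodic_translate[OF M, of y] periodic_translate_minus[OF M, of y]
      by (simp add: periodic_def)
    from sum_translate[OF this n, of y]
    show "(\<Sum>x\<in>torus n d. of_bool (?P y x) :: real) =
        (\<Sum>x\<in>torus n d. of_bool (M (x - y) = C \<and> M x = A \<and> M (x + y) = T))"
      by simp
  qed
  finally show ?thesis .
qed

text \<open>Used to exchange the two ends of an opposite pair; the restriction keeps the reversed
  move extensional.\<close>

lemma sum_king_moves_negate:
  "(\<Sum>y\<in>king_moves d. g (\<lambda>i\<in>{..<d}. - y i)) = (\<Sum>y\<in>king_moves d. g y)"
proof (rule sum.reindex_bij_witness[where i = "\<lambda>y. \<lambda>i\<in>{..<d}. - y i" and j = "\<lambda>y. \<lambda>i\<in>{..<d}. - y i"])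
  fix y assume y: "y \<in> king_moves d"
  show "(\<lambda>i\<in>{..<d}. - (\<lambda>i\<in>{..<d}. - y i) i) = y"
  proof (rule ext)
    fix i show "(\<lambda>i\<in>{..<d}. - (\<lambda>i\<in>{..<d}. - y i) i) i = y i"
      using y PiE_arb[of y "{..<d}" _ i] by (simp add: king_moves_def restrict_def)
  qed
  then show "(\<lambda>i\<in>{..<d}. - (\<lambda>i\<in>{..<d}. - y i) i) = y" .
  have "- y i \<in> {-1, 0, 1}" if "i < d" for i
  proof -
    have "y i \<in> {-1, 0, 1}"
      using y that unfolding king_moves_def by (intro PiE_mem[of y]) auto
    then show ?thesis by auto
  qed
  then show "(\<lambda>i\<in>{..<d}. - y i) \<in> king_moves d"
    unfolding king_moves_def restrict_PiE_iff by simp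
  then show "(\<lambda>i\<in>{..<d}. - y i) \<in> king_moves d" .
qed simp

text \<open>A cut edge from an \<open>A\<close> at \<open>x\<close> to \<open>x + y\<close> leads to
  the \<open>T\<close> of an occurrence, to the \<open>C\<close> of one, or is a defect. Reversing
  \<open>y\<close> equates the first two counts, so every occurrence is counted twice.\<close>

lemma CAT_occurrences_identity:
  fixes n d :: nat and L :: "(nat \<Rightarrow> int) \<Rightarrow> letter"
  assumes n: "n > 0"
  defines "M \<equiv> \<lambda>x. L (reduce n d x)"
  shows "8 * real (card (CAT_occurrences n d L)) = 3 ^ d * real n ^ d - king_form n d d (a_sign M)
    - 4 * (\<Sum>y\<in>king_moves d. \<Sum>x\<in>torus n d. of_bool (defect M x y))"
proof -
  let ?f = "a_sign M"
  let ?S = "\<lambda>g. \<Sum>y\<in>king_moves d. \<Sum>x\<in>torus n d. (g y x :: real)"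
  let ?G = "\<lambda>y x. of_bool (M (x - y) = C \<and> M x = A \<and> M (x + y) = T)"
  let ?H = "\<lambda>y x. of_bool (M (x + y) = C \<and> M x = A \<and> M (x - y) = T)"
  have M: "periodic n d M"
    unfolding M_def by (rule periodic_lift)
  note f = periodic_a_sign[OF M]
  \<comment> \<open>Here \<open>s\<close> stands for the total of the sign over points and moves;
    the two linear terms contribute it with opposite signs.\<close>
  have arith: "8 * g = t - k - 4 * e" if "4 * (g + h + e) = t - s + s - k" "h = g" for e g h k s t :: real
    using that by simp
  have N: "real (card (CAT_occurrences n d L)) = ?S ?G"
    unfolding M_def by (rule card_CAT_occurrences[OF n])
  have "?S ?H = ?S ?G"
  proof -
    have "?S ?H = (\<Sum>y\<in>king_moves d. \<Sum>x\<in>torus n d. ?G (\<lambda>i\<in>{..<d}. - y i) x)"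
    proof (intro sum.cong refl)
      fix y x
      have "M (x - (\<lambda>i\<in>{..<d}. - y i)) = M (x + y)" "M (x + (\<lambda>i\<in>{..<d}. - y i)) = M (x - y)"
        by (rule periodic_cong[OF M]; simp add: plus_fun_apply minus_apply)+
      then show "?H y x = ?G (\<lambda>i\<in>{..<d}. - y i) x" by simp
    qed
    also have "\<dots> = ?S ?G"
      by (rule sum_king_moves_negate)
    finally show ?thesis .
  qed
  \<comment> \<open>The right side is \<open>(1 + ?f x) * (1 - ?f (x + y))\<close>: 4 on a cut edge
    leaving an \<open>A\<close> at \<open>x\<close>, and 0 otherwise.\<close>
  have pt: "4 * (?G y x + ?H y x + of_bool (defect M x y)) = 1 - ?f (x + y) + ?f x - ?f x * ?f (x + y)"
    for y x
    by (cases "M x"; cases "M (x + y)"; cases "M (x - y)")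
      (simp_all add: defect_def a_sign_def doubleton_eq_iff)
  have "4 * (?S ?G + ?S ?H + ?S (\<lambda>y x. of_bool (defect M x y))) =
      ?S (\<lambda>y x. 4 * (?G y x + ?H y x + of_bool (defect M x y)))"
    by (simp only: sum_distrib_left sum.distrib distrib_left)
  also have "\<dots> = ?S (\<lambda>y x. 1 - ?f (x + y) + ?f x - ?f x * ?f (x + y))"
    by (simp only: pt)
  also have "\<dots> = ?S (\<lambda>y x. 1) - ?S (\<lambda>y x. ?f (x + y)) + ?S (\<lambda>y x. ?f x) - ?S (\<lambda>y x. ?f x * ?f (x + y))"
    by (simp only: sum.distrib sum_subtractf)
  also have "?S (\<lambda>y x. ?f (x + y)) = ?S (\<lambda>y x. ?f x)"
    by (simp only: sum_translate[OF f n])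
  also have "?S (\<lambda>y x. 1) = 3 ^ d * real n ^ d"
    by (simp add: card_torus card_king_moves)
  also have "?S (\<lambda>y x. ?f x * ?f (x + y)) = king_form n d d ?f"
    unfolding king_form_def nbr_sum_periodic[OF f] sum_distrib_left king_moves_def
    by (rule sum.swap)
  finally show ?thesis
    unfolding N using \<open>?S ?H = ?S ?G\<close> by (rule arith)
qed

text \<open>Frees the condition from extensional moves and reduced points, so that vectors such as
  \<open>axis r 1\<close>, which are 0 rather than \<open>undefined\<close> outside the range, can
  be inserted.\<close>

lemma no_defects_iff:
  assumes n: "n > 0" and M: "periodic n d M"
  shows "(\<Sum>y\<in>king_moves d. \<Sum>x\<in>torus n d. of_bool (defect M x y) :: real) = 0 \<longleftrightarrow>
    (\<forall>x v. (\<forall>i<d. v i \<in> {-1, 0, 1}) \<longrightarrow> \<not> defect M x v)" (is "?l \<longleftrightarrow> ?r")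
proof -
  have "?l \<longleftrightarrow> (\<forall>y\<in>king_moves d. \<forall>x\<in>torus n d. \<not> defect M x y)"
    by (auto simp: sum_nonneg_eq_0_iff sum_nonneg finite_king_moves finite_torus)
  also have "\<dots> \<longleftrightarrow> ?r"
  proof (intro iffI allI impI)
    fix x v assume *: "\<forall>y\<in>king_moves d. \<forall>x\<in>torus n d. \<not> defect M x y"
      and v: "\<forall>i<d. v i \<in> {-1, 0, 1 :: int}"
    let ?v = "restrict v {..<d}"
    have "?v \<in> king_moves d"
      using v by (simp add: king_moves_def restrict_PiE_iff)
    with * reduce_in_torus[OF n, of d x] have "\<not> defect M (reduce n d x) ?v"
      by blast
    moreover have "M (reduce n d x) = M x" "M (reduce n d x + ?v) = M (x + v)"
      "M (reduce n d x - ?v) = M (x - v)"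
      by (rule periodic_cong[OF M]; simp add: plus_fun_apply minus_apply reduce_def mod_simps)+
    ultimately show "\<not> defect M x v" by (simp add: defect_def)
  next
    assume ?r
    then show "\<forall>y\<in>king_moves d. \<forall>x\<in>torus n d. \<not> defect M x y"
      unfolding king_moves_def by (meson PiE_mem lessThan_iff)
  qed
  finally show ?thesis .
qed

subsection \<open>Extremal labelings\<close>

text \<open>Exchanging \<open>C\<close> and \<open>T\<close> becomes negation, so the results on
  alternating functions apply to the labels as well.\<close>

definition letter_sign :: "letter \<Rightarrow> real" where
  "letter_sign l = (case l of A \<Rightarrow> 0 | C \<Rightarrow> 1 | T \<Rightarrow> -1)"

lemma letter_sign_simps [simp]: "letter_sign A = 0" "letter_sign C = 1" "letter_sign T = -1"
  by (simp_all add: letter_sign_def)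

text \<open>The sign of \<open>A\<close> flips under \<open>v\<close> because \<open>v r\<close> is
  odd. If \<open>x\<close> is not an \<open>A\<close>, then \<open>x + v\<close> is one, and its
  opposite neighbours \<open>x\<close> and \<open>x + v + v\<close> must be \<open>C\<close> and
  \<open>T\<close>.\<close>

lemma alternating_no_defect_flip:
  assumes M: "periodic n d M"
    and inv: "\<And>i x. i < d \<Longrightarrow> i \<noteq> r \<Longrightarrow> a_sign M (x + axis i 1) = a_sign M x"
    and alt: "\<And>x. a_sign M (x + axis r 1) = - a_sign M x"
    and nodef: "\<And>x v. (\<And>i. i < d \<Longrightarrow> v i \<in> {-1, 0, 1}) \<Longrightarrow> \<not> defect M x v"
    and v: "\<And>i. i < d \<Longrightarrow> v i \<in> {-1, 0, 1}" "odd (v r)"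
  shows "letter_sign (M (x + v + v)) = - letter_sign (M x)"
proof -
  have f: "a_sign M (y + v) = - a_sign M y" for y
    using translate_alternating[of n d "a_sign M" r 1 y v] periodic_a_sign[OF M] inv alt v(2) by simp
  show ?thesis
  proof (cases "M x = A")
    case True
    then have "a_sign M (x + v + v) = 1"
      by (simp only: f) (simp add: a_sign_def)
    then have "M (x + v + v) = A" by (simp only: a_sign_eq_iff)
    with True show ?thesis by simp
  next
    case False
    then have 1: "a_sign M x = -1" by (simp add: a_sign_def)
    have "a_sign M (x + v) = 1" by (simp add: f 1)
    moreover from this have "a_sign M (x + v + v) = -1" by (simp only: f)
    ultimately have "M (x + v) = A" "M (x + v + v) \<noteq> A" by (simp_all add: a_sign_eq_iff)
    with nodef[of v "x + v"] v(1) have "{M (x + v + v), M x} = {C, T}"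
      unfolding defect_def by simp
    then show ?thesis by (auto simp: doubleton_eq_iff)
  qed
qed

lemma alternating_no_defect_imp_Patchell_Spiro:
  fixes n d :: nat and L :: "(nat \<Rightarrow> int) \<Rightarrow> letter"
  defines "M \<equiv> \<lambda>x. L (reduce n d x)"
  assumes n: "n > 0" and r: "r < d"
    and inv: "\<And>i x. i < d \<Longrightarrow> i \<noteq> r \<Longrightarrow> a_sign M (x + axis i 1) = a_sign M x"
    and alt: "\<And>x. a_sign M (x + axis r 1) = - a_sign M x"
    and nodef: "\<And>x v. (\<And>i. i < d \<Longrightarrow> v i \<in> {-1, 0, 1}) \<Longrightarrow> \<not> defect M x v"
  shows "4 dvd n \<and> generalized_Patchell_Spiro n d L"
proof -
  have M: "periodic n d M"
    unfolding M_def by (rule periodic_lift)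
  define H where "H = (\<lambda>x. letter_sign (M x))"
  have H: "periodic n d H"
    unfolding H_def by (rule periodic_comp[OF M])
  have f: "a_sign M (x + v) = (if even (v r) then a_sign M x else - a_sign M x)" for x v
    using translate_alternating[of n d "a_sign M" r 1 x v] periodic_a_sign[OF M] inv alt by simp
  have flip: "H (x + v + v) = - H x" if "\<And>i. i < d \<Longrightarrow> v i \<in> {-1, 0, 1}" "odd (v r)" for x v
    unfolding H_def using alternating_no_defect_flip[of n d M r v x] M inv alt nodef that by blast
  have Hr: "H (x + axis r 2) = - H x" for x
  proof -
    have "x + axis r 1 + axis r 1 = x + axis r 2"
      by (rule ext) (simp add: axis_def plus_fun_apply)
    moreover have "H (x + axis r 1 + axis r 1) = - H x"
      by (rule flip) (auto simp: axis_def)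
    ultimately show ?thesis by (simp only:)
  qed
  \<comment> \<open>Two diagonal steps \<open>axis r 1 + axis i 1\<close> negate \<open>H\<close>,
    and so do two steps along \<open>r\<close> alone; what remains is translation by 2 along
    \<open>i\<close>.\<close>
  have Hi: "H (x + axis i 2) = H x" if "i \<noteq> r" for x i
  proof -
    have "x + (axis r 1 + axis i 1) + (axis r 1 + axis i 1) = x + axis i 2 + axis r 2"
      by (rule ext) (simp add: axis_def plus_fun_apply)
    moreover have "H (x + (axis r 1 + axis i 1) + (axis r 1 + axis i 1)) = - H x"
      using that by (intro flip) (auto simp: axis_def plus_fun_apply)
    ultimately have "- H (x + axis i 2) = - H x"
      using Hr[of "x + axis i 2"] by (simp only:)
    then show ?thesis by simp
  qed
  have H2: "H (x + (\<lambda>i. 2 * w i)) = (if even (w r) then H x else - H x)" for x w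
    using translate_alternating[of n d H r 2 x w] H Hi Hr by blast
  \<comment> \<open>The translation vector has to be an \<open>A\<close>; by alternation the origin
    or its neighbour along \<open>r\<close> is one.\<close>
  obtain a where a: "a \<in> torus n d" "a_sign M a = 1"
  proof -
    let ?z = "reduce n d 0" and ?e = "reduce n d (0 + axis r 1)"
    have "a_sign M ?z = a_sign M 0" "a_sign M ?e = a_sign M (0 + axis r 1)"
      by (rule periodicD[OF periodic_a_sign[OF M]])+
    then have "a_sign M ?z = 1 \<or> a_sign M ?e = 1"
      using alt[of 0] a_sign_cases[of M 0] by auto
    then show thesis
      using that reduce_in_torus[OF n] by blast
  qed
  have nonzero: "H (a + v) = 1 \<or> H (a + v) = -1" if "odd (v r)" for v
  proof -
    have "a_sign M (a + v) = -1" using that a(2) f[of a v] by simp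
    then have "M (a + v) \<noteq> A" by (simp add: a_sign_eq_iff)
    then show ?thesis unfolding H_def by (cases "M (a + v)") auto
  qed
  \<comment> \<open>Going once round axis \<open>r\<close> returns to the same label. Unit steps
    alternate the sign of \<open>A\<close>, so \<open>n\<close> is even; steps of length 2 alternate
    the nonzero value of \<open>H\<close> at an odd position, so \<open>n / 2\<close> is
    even.\<close>
  have "4 dvd n"
  proof -
    have "a_sign M (a + axis r (int n)) = a_sign M a"
      by (rule periodic_cong[OF periodic_a_sign[OF M]]) (simp add: axis_def plus_fun_apply)
    then have "even (int n)"
      using f[of a "axis r (int n)"] a(2) by (auto simp: axis_def split: if_splits)
    then obtain m where m: "int n = 2 * m" by (elim evenE)
    have "H (a + axis r 1 + (\<lambda>i. 2 * axis r m i)) = H (a + axis r 1)"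
      by (rule periodic_cong[OF H]) (simp add: axis_def plus_fun_apply m)
    then have "even m"
      using H2[of "a + axis r 1" "axis r m"] nonzero[of "axis r 1"]
      by (auto simp: axis_def split: if_splits)
    with m have "4 dvd int n" by auto
    then show "4 dvd n" by presburger
  qed
  \<comment> \<open>\<open>q y\<close> reinserts the deleted coordinate with the value 1. The letter
    at \<open>a + q y\<close> decides \<open>\<epsilon> y\<close>: 1 if \<open>C\<close> stands at
    residue 1, and 3 if it is \<open>T\<close>.\<close>
  define q where "q = (\<lambda>y i. if i < r then y i else if i = r then 1 else y (i - 1) :: int)"
  define \<epsilon> where "\<epsilon> = (\<lambda>y. if H (a + q y) = 1 then 1 else 3 :: int)"
  have "generalized_Patchell_Spiro n d L"
    unfolding generalized_Patchell_Spiro_def Let_def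
  proof (rule exI[of _ r], intro conjI r bexI[OF _ a(1)] bexI[of _ \<epsilon>] ballI)
    show "\<epsilon> \<in> ({..<d - 1} \<rightarrow>\<^sub>E {0, 1}) \<rightarrow> {1, 3}" by (simp add: \<epsilon>_def)
    fix x assume x: "x \<in> torus n d"
    define z where "z = shift n d x (-1) a"
    have z: "z i mod int n = (x i - a i) mod int n" if "i < d" for i
      using that by (simp add: z_def shift_def)
    have "M (a + z) = M x"
    proof (rule periodic_cong[OF M])
      fix i assume "i < d"
      have "(a + z) i mod int n = (a i + z i mod int n) mod int n"
        by (simp add: plus_fun_apply mod_simps)
      also have "\<dots> = x i mod int n" unfolding z[OF \<open>i < d\<close>] by (simp add: mod_simps)
      finally show "(a + z) i mod int n = x i mod int n" .
    qed
    also have "M x = L x" using x by (simp add: M_def reduce_torus)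
    finally have Lx: "M (a + z) = L x" .
    let ?y = "delete_mod2 d r z"
    have even: "L x = A" if "even (z r)"
    proof -
      have "a_sign M (a + z) = 1" using f[of a z] that a(2) by simp
      then show ?thesis by (simp only: a_sign_eq_iff Lx)
    qed
    have odd: "letter_sign (L x) = (if even ((z r - 1) div 2) then H (a + q ?y) else - H (a + q ?y))"
      if "odd (z r)"
    proof -
      \<comment> \<open>Half the displacement of \<open>z\<close> from the representative
        \<open>q ?y\<close>; at \<open>r\<close> the inserted 1 is subtracted before
        halving.\<close>
      define w where "w = (\<lambda>i. if i = r then (z r - 1) div 2 else z i div 2)"
      have "H (a + z) = H (a + q ?y + (\<lambda>i. 2 * w i))"
      proof (rule periodic_cong[OF H])
        fix i assume i: "i < d"
        have "z i = q ?y i + 2 * w i"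
        proof -
          consider "i < r" | "i = r" | "i > r" by linarith
          then show ?thesis
          proof cases
            case 1
            then have "i < d - 1" using r by linarith
            with 1 show ?thesis by (simp add: q_def w_def delete_mod2_def)
          next
            case 2
            then show ?thesis using that by (simp add: q_def w_def)
          next
            case 3
            then have "i - 1 < d - 1" "\<not> i - 1 < r" "Suc (i - 1) = i" using i by linarith+
            with 3 show ?thesis by (simp add: q_def w_def delete_mod2_def)
          qed
        qed
        then show "(a + z) i mod int n = (a + q ?y + (\<lambda>i. 2 * w i)) i mod int n"
          by (simp add: plus_fun_apply add.assoc)
      qed
      also have "\<dots> = (if even (w r) then H (a + q ?y) else - H (a + q ?y))" by (rule H2)
      finally show ?thesis unfolding Lx[symmetric] by (simp add: H_def w_def)
    qed
    have qH: "H (a + q ?y) = 1 \<or> H (a + q ?y) = -1"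
      by (rule nonzero) (simp add: q_def)
    have C: "L x = C" if "letter_sign (L x) = 1" using that by (cases "L x") auto
    have T: "L x = T" if "letter_sign (L x) = -1" using that by (cases "L x") auto
    have m4: "even ((z r - 1) div 2) \<longleftrightarrow> z r mod 4 = 1" "odd ((z r - 1) div 2) \<longleftrightarrow> z r mod 4 = 3"
      if "odd (z r)" using that by presburger+
    show "even (z r) \<longrightarrow> L x = A" using even by blast
    show "odd (z r) \<and> z r mod 4 = \<epsilon> ?y mod 4 \<longrightarrow> L x = C"
      using odd m4 qH C by (auto simp: \<epsilon>_def split: if_splits)
    show "odd (z r) \<and> z r mod 4 = (\<epsilon> ?y + 2) mod 4 \<longrightarrow> L x = T"
      using odd m4 qH T by (auto simp: \<epsilon>_def split: if_splits)
  qed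
  with \<open>4 dvd n\<close> show ?thesis by blast
qed

text \<open>As 4 divides \<open>n\<close>, residues modulo 2 and 4 survive reduction, and the
  defining rule extends to the whole lattice. At a cut edge of an \<open>A\<close> the two opposite
  points share their parity class and differ by 2 modulo 4 in coordinate \<open>r\<close>.\<close>

lemma Patchell_Spiro_imp_alternating_no_defect:
  fixes n d :: nat and L :: "(nat \<Rightarrow> int) \<Rightarrow> letter"
  defines "M \<equiv> \<lambda>x. L (reduce n d x)"
  assumes n: "n > 0" "4 dvd n" and PS: "generalized_Patchell_Spiro n d L"
  obtains r where "r < d" "\<And>i x. i \<noteq> r \<Longrightarrow> a_sign M (x + axis i 1) = a_sign M x"
    "\<And>x. a_sign M (x + axis r 1) = - a_sign M x"
    "\<And>x v. (\<And>i. i < d \<Longrightarrow> v i \<in> {-1, 0, 1}) \<Longrightarrow> \<not> defect M x v"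
proof -
  from PS obtain r a \<epsilon> where r: "r < d"
    and \<epsilon>: "\<epsilon> \<in> ({..<d - 1} \<rightarrow>\<^sub>E {0, 1}) \<rightarrow> {1, 3 :: int}"
    and L: "\<And>x. x \<in> torus n d \<Longrightarrow>
      (even (shift n d x (-1) a r) \<longrightarrow> L x = A) \<and>
      (odd (shift n d x (-1) a r) \<and>
        shift n d x (-1) a r mod 4 = \<epsilon> (delete_mod2 d r (shift n d x (-1) a)) mod 4 \<longrightarrow> L x = C) \<and>
      (odd (shift n d x (-1) a r) \<and>
        shift n d x (-1) a r mod 4 = (\<epsilon> (delete_mod2 d r (shift n d x (-1) a)) + 2) mod 4 \<longrightarrow> L x = T)"
    unfolding generalized_Patchell_Spiro_def Let_def by blast
  have 4: "4 dvd int n" using n(2) by presburger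
  then have 2: "2 dvd int n" by presburger
  let ?s = "\<lambda>x. x r - a r" and ?y = "\<lambda>x. delete_mod2 d r (x - a)"
  have M: "(even (?s x) \<longrightarrow> M x = A) \<and> (odd (?s x) \<and> ?s x mod 4 = \<epsilon> (?y x) mod 4 \<longrightarrow> M x = C) \<and>
    (odd (?s x) \<and> ?s x mod 4 = (\<epsilon> (?y x) + 2) mod 4 \<longrightarrow> M x = T)" for x
  proof -
    let ?z = "shift n d (reduce n d x) (-1) a"
    have z: "?z i = (x i - a i) mod int n" if "i < d" for i
      using that by (simp add: shift_def reduce_def mod_simps)
    have "?z r mod 4 = ?s x mod 4"
      by (simp add: z[OF r] mod_mod_cancel[OF 4])
    moreover from this have "even (?z r) \<longleftrightarrow> even (?s x)" by presburger
    moreover have "delete_mod2 d r ?z = ?y x"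
    proof (rule ext)
      fix i
      have "(if i < r then ?z i else ?z (Suc i)) mod 2 = (if i < r then (x - a) i else (x - a) (Suc i)) mod 2"
        if "i < d - 1"
        using that by (auto simp: z minus_apply mod_mod_cancel[OF 2])
      then show "delete_mod2 d r ?z i = ?y x i" by (simp add: delete_mod2_def)
    qed
    ultimately show ?thesis
      using L[OF reduce_in_torus[OF n(1), of d x]] unfolding M_def by metis
  qed
  have \<epsilon>13: "\<epsilon> (?y x) = 1 \<or> \<epsilon> (?y x) = 3" for x
  proof -
    have "?y x \<in> {..<d - 1} \<rightarrow>\<^sub>E {0, 1}" by (auto simp: delete_mod2_def restrict_PiE_iff mod_2_eq_odd)
    from PiE_mem[of \<epsilon>] funcset_mem[OF \<epsilon> this] show ?thesis by blast
  qed
  have odd: "M x = (if ?s x mod 4 = \<epsilon> (?y x) then C else T)" if "odd (?s x)" for x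
  proof -
    have "?s x mod 4 = 1 \<or> ?s x mod 4 = 3" using that by presburger
    with M[of x] \<epsilon>13[of x] that show ?thesis by auto
  qed
  \<comment> \<open>\<open>s + w\<close> and \<open>s - w\<close> run through both odd residues
    modulo 4, so exactly one of them is \<open>e\<close>.\<close>
  have arith: "(s + w) mod 4 = e \<longleftrightarrow> (s - w) mod 4 \<noteq> e"
    if "e = 1 \<or> e = 3" "w = 1 \<or> w = -1" "even s" for s w e :: int
    using that by (elim disjE; hypsubst; presburger)
  have A: "M x = A \<longleftrightarrow> even (?s x)" for x
    using M[of x] odd[of x] by (metis letter.distinct(1,5))
  show thesis
  proof (rule that[of r])
    show "r < d" by (fact r)
    show "a_sign M (x + axis i 1) = a_sign M x" if "i \<noteq> r" for i x
      using that by (simp add: a_sign_def A axis_def plus_fun_apply)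
    show "a_sign M (x + axis r 1) = - a_sign M x" for x
      by (simp add: a_sign_def A axis_def plus_fun_apply)
    show "\<not> defect M x v" if "\<And>i. i < d \<Longrightarrow> v i \<in> {-1, 0, 1}" for x v
    proof
      assume def: "defect M x v"
      \<comment> \<open>The two points differ by \<open>2 * v i\<close> in each coordinate.\<close>
      have y: "?y (x + v) = ?y (x - v)"
      proof -
        have "(x + v - a) i mod 2 = (x - v - a) i mod 2" for i
          unfolding plus_fun_apply minus_apply by presburger
        then show ?thesis by (auto simp: delete_mod2_def)
      qed
      from def have "even (?s x)" "odd (?s x + v r)" "{M (x + v), M (x - v)} \<noteq> {C, T}"
        by (auto simp: defect_def A plus_fun_apply)
      with that[OF r] have v: "v r = 1 \<or> v r = -1" by auto
      have s: "?s (x + v) = ?s x + v r" "?s (x - v) = ?s x - v r"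
        by (simp_all add: plus_fun_apply minus_apply)
      have "odd (?s (x + v))" "odd (?s (x - v))"
        using \<open>even (?s x)\<close> v unfolding s by auto
      note odd[of "x + v", OF this(1)] odd[of "x - v", OF this(2)]
      moreover have "?s (x + v) mod 4 = \<epsilon> (?y (x + v)) \<longleftrightarrow> ?s (x - v) mod 4 \<noteq> \<epsilon> (?y (x - v))"
        using \<epsilon>13[of "x + v"] v \<open>even (?s x)\<close> unfolding s y[symmetric] by (intro arith)
      ultimately have "{M (x + v), M (x - v)} = {C, T}"
        by (auto simp: doubleton_eq_iff)
      with \<open>{M (x + v), M (x - v)} \<noteq> {C, T}\<close> show False by blast
    qed
  qed
qed

theorem theorem1p1:
  fixes d n :: nat and L :: "(nat \<Rightarrow> int) \<Rightarrow> letter"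
  assumes "d \<ge> 1" and "n \<ge> 3"
  shows "real (card (CAT_occurrences n d L)) \<le> 3 ^ (d - 1) / 2 * real n ^ d \<and>
    (real (card (CAT_occurrences n d L)) = 3 ^ (d - 1) / 2 * real n ^ d \<longleftrightarrow>
       4 dvd n \<and> generalized_Patchell_Spiro n d L)"
proof -
  define M where "M = (\<lambda>x. L (reduce n d x))"
  let ?N = "real (card (CAT_occurrences n d L))" and ?f = "a_sign M"
  let ?D = "\<Sum>y\<in>king_moves d. \<Sum>x\<in>torus n d. of_bool (defect M x y) :: real"
  have n: "n > 0" using assms by simp
  have M: "periodic n d M"
    unfolding M_def by (rule periodic_lift)
  note f = periodic_a_sign[OF M]
  have id: "8 * ?N = 3 ^ d * real n ^ d - king_form n d d ?f - 4 * ?D"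
    using CAT_occurrences_identity[OF n, of d L] unfolding M_def .
  have "3 ^ d = (3 * 3 ^ (d - 1) :: real)"
    using assms(1) by (simp flip: power_Suc)
  then have max: "3 ^ (d - 1) / 2 * real n ^ d = 3 ^ d * real n ^ d / 6" by simp
  have low: "- (3 ^ d * real n ^ d) \<le> 3 * king_form n d d ?f"
    using king_form_bounds(1)[OF f n, of d] unfolding sq_norm_a_sign .
  have D: "0 \<le> ?D" by (intro sum_nonneg) simp
  \<comment> \<open>The identity bounds \<open>8 * ?N\<close> by \<open>4 / 3\<close> times
    \<open>3 ^ d * real n ^ d\<close>, losing through a form above its minimum and through defects;
    equality means that both losses are zero.\<close>
  have "?N = 3 ^ (d - 1) / 2 * real n ^ d \<longleftrightarrow> 3 * king_form n d d ?f = - (3 ^ d * real n ^ d) \<and> ?D = 0"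
    unfolding max using id low D by (intro iffI conjI) linarith+
  also have "\<dots> \<longleftrightarrow> 4 dvd n \<and> generalized_Patchell_Spiro n d L"
  proof
    assume *: "3 * king_form n d d ?f = - (3 ^ d * real n ^ d) \<and> ?D = 0"
    then have "3 * king_form n d d ?f = - (3 ^ d * sq_norm n d ?f)"
      by (simp only: sq_norm_a_sign)
    then obtain r where "r < d" "\<And>x. ?f (x + axis r 1) = - ?f x"
      "\<And>i x. i < d \<Longrightarrow> i \<noteq> r \<Longrightarrow> ?f (x + axis i 1) = ?f x"
      using sign_function_min_alternating[of n d ?f] f n assms(1) a_sign_cases[of M] by auto
    moreover have "\<And>x v. (\<And>i. i < d \<Longrightarrow> v i \<in> {-1, 0, 1}) \<Longrightarrow> \<not> defect M x v"
      using * no_defects_iff[OF n M] by blast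
    ultimately show "4 dvd n \<and> generalized_Patchell_Spiro n d L"
      unfolding M_def using alternating_no_defect_imp_Patchell_Spiro[OF n] by blast
  next
    assume PS: "4 dvd n \<and> generalized_Patchell_Spiro n d L"
    show "3 * king_form n d d ?f = - (3 ^ d * real n ^ d) \<and> ?D = 0"
    proof (rule Patchell_Spiro_imp_alternating_no_defect[of n d L, folded M_def])
      show "n > 0" "4 dvd n" "generalized_Patchell_Spiro n d L"
        using n PS by auto
    next
      fix r assume r: "r < d" "\<And>i x. i \<noteq> r \<Longrightarrow> ?f (x + axis i 1) = ?f x"
        "\<And>x. ?f (x + axis r 1) = - ?f x"
        "\<And>x v. (\<And>i. i < d \<Longrightarrow> v i \<in> {-1, 0, 1}) \<Longrightarrow> \<not> defect M x v"
      \<comment> \<open>The sign is an eigenfunction with eigenvalue \<open>- (3 ^ d) / 3\<close>,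
        so its form attains the lower bound.\<close>
      have R: "3 * nbr_sum d ?f x = - (3 ^ d) * ?f x" for x
        using nbr_sum_alternating[of r d ?f x] r(1-3) by blast
      have "3 * king_form n d d ?f = (\<Sum>x\<in>torus n d. ?f x * (3 * nbr_sum d ?f x))"
        by (simp add: king_form_def sum_distrib_left mult_ac)
      also have "\<dots> = - (3 ^ d * sq_norm n d ?f)"
        unfolding R by (simp add: sq_norm_def sum_distrib_left power2_eq_square mult_ac sum_negf)
      finally have "3 * king_form n d d ?f = - (3 ^ d * real n ^ d)"
        by (simp only: sq_norm_a_sign)
      moreover have "?D = 0"
        using no_defects_iff[OF n M] r(4) by blast
      ultimately show ?thesis by blast
    qed
  qed
  finally have "?N = 3 ^ (d - 1) / 2 * real n ^ d \<longleftrightarrow> 4 dvd n \<and> generalized_Patchell_Spiro n d L" .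
  moreover have "?N \<le> 3 ^ (d - 1) / 2 * real n ^ d"
    unfolding max using id low D by linarith
  ultimately show ?thesis by blast
qed

end
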